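(* Let $a,b,c,\alpha,\beta,\gamma$ be integers with $0\le\alpha<a$, $0\le\beta<b$, $0\le\gamma<c$ and at most one of $\alpha,\beta,\gamma$ zero. Suppose $a+b+c+\alpha+\beta+\gamma\equiv 0\pmod 3$, put $s=\frac13(a+b+c+\alpha+\beta+\gamma)-2$, $A=s+2-a$, $B=s+2-b$, $C=s+2-c$, $M=s+2-(\alpha+\beta+\gamma)$, and assume $0\le M$, $0\le A\le\beta+\gamma$, $0\le B\le\alpha+\gamma$, $0\le C\le\alpha+\beta$. Then $$|\det Z_{a,b,c,\alpha,\beta,\gamma}|=|\det N_{a,b,c,\alpha,\beta,\gamma}|.$$
   Context: $Z_{a,b,c,\alpha,\beta,\gamma}$ is the integer matrix with rows indexed by the monomials $m_i$ in $x,y,z$ of degree $s$ not in the ideal $I=(x^a,y^b,z^c,x^\alpha y^\beta z^\gamma)$ and columns indexed by the monomials $n_j$ of degree $s+1$ not in $I$ (both in lexicographic order; the numbers of rows and columns agree under the hypotheses), with entry $1$ if $m_i$ divides $n_j$ and $0$ otherwise. $N_{a,b,c,\alpha,\beta,\gamma}$ is the $(C+M)\times(C+M)$ integer matrix with $(i,j)$ entry $\binom{c}{A+j-i}$ if $1\le i\le C$ and $\binom{\gamma}{A+C-\beta+j-i}$ if $C+1\le i\le C+M$, where $\binom nk=0$ if $k<0$ or $k>n$ (determinant of the empty matrix is $1$). The hypotheses on the parameters are exactly those under which the paper associates to them a punctured hexagon $H_{a,b,c,\alpha,\beta,\gamma}$. *)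

theory Defs
  imports
    "HOL-Library.Poly_Mapping"
    "HOL-Library.Product_Plus"
    "HOL-Library.Product_Lexorder"
    "Jordan_Normal_Form.Determinant"
begin

text \<open>
  Polynomials in three variables form the monoid algebra of \<open>\<nat> \<times> \<nat> \<times> \<nat>\<close>: an
  exponent triple \<open>(i, j, k)\<close> stands for the monomial $x^i y^j z^k$, and the multiplication
  of \<open>poly_mapping\<close> is convolution along the componentwise addition of exponents.
  The coefficient field plays no role for the matrices below.
\<close>

type_synonym poly3 = "(nat \<times> nat \<times> nat) \<Rightarrow>\<^sub>0 rat"

definition mono3 :: "nat \<times> nat \<times> nat \<Rightarrow> poly3" where
  "mono3 e = Poly_Mapping.single e 1"

text \<open>
  The span in the ring regarded as a module over itself is the generated ideal.
  (\<open>Modules.module\<close> is the locale of HOL, not the one of HOL-Algebra.)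
\<close>

definition ideal_gen :: "poly3 set \<Rightarrow> poly3 set" where
  "ideal_gen G = Modules.module.span (*) G"

lemma module_poly3: "Modules.module ((*) :: poly3 \<Rightarrow> poly3 \<Rightarrow> poly3)"
  by unfold_locales (simp_all add: algebra_simps)

definition ideal_I :: "nat \<Rightarrow> nat \<Rightarrow> nat \<Rightarrow> nat \<Rightarrow> nat \<Rightarrow> nat \<Rightarrow> poly3 set" where
  "ideal_I a b c \<alpha> \<beta> \<gamma> =
     ideal_gen {mono3 (a, 0, 0), mono3 (0, b, 0), mono3 (0, 0, c), mono3 (\<alpha>, \<beta>, \<gamma>)}"

definition par_s :: "nat \<Rightarrow> nat \<Rightarrow> nat \<Rightarrow> nat \<Rightarrow> nat \<Rightarrow> nat \<Rightarrow> int" where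
  "par_s a b c \<alpha> \<beta> \<gamma> = int (a + b + c + \<alpha> + \<beta> + \<gamma>) div 3 - 2"

definition par_A :: "nat \<Rightarrow> nat \<Rightarrow> nat \<Rightarrow> nat \<Rightarrow> nat \<Rightarrow> nat \<Rightarrow> int" where
  "par_A a b c \<alpha> \<beta> \<gamma> = par_s a b c \<alpha> \<beta> \<gamma> + 2 - int a"

definition par_B :: "nat \<Rightarrow> nat \<Rightarrow> nat \<Rightarrow> nat \<Rightarrow> nat \<Rightarrow> nat \<Rightarrow> int" where
  "par_B a b c \<alpha> \<beta> \<gamma> = par_s a b c \<alpha> \<beta> \<gamma> + 2 - int b"

definition par_C :: "nat \<Rightarrow> nat \<Rightarrow> nat \<Rightarrow> nat \<Rightarrow> nat \<Rightarrow> nat \<Rightarrow> int" where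
  "par_C a b c \<alpha> \<beta> \<gamma> = par_s a b c \<alpha> \<beta> \<gamma> + 2 - int c"

definition par_M :: "nat \<Rightarrow> nat \<Rightarrow> nat \<Rightarrow> nat \<Rightarrow> nat \<Rightarrow> nat \<Rightarrow> int" where
  "par_M a b c \<alpha> \<beta> \<gamma> = par_s a b c \<alpha> \<beta> \<gamma> + 2 - int (\<alpha> + \<beta> + \<gamma>)"

text \<open>
  The exponents of the monomials of degree \<open>d\<close> outside the ideal, listed in the increasing
  lexicographic order of \<open>\<nat> \<times> \<nat> \<times> \<nat>\<close>.
\<close>

definition mons :: "nat \<Rightarrow> nat \<Rightarrow> nat \<Rightarrow> nat \<Rightarrow> nat \<Rightarrow> nat \<Rightarrow> int \<Rightarrow> (nat \<times> nat \<times> nat) list" where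
  "mons a b c \<alpha> \<beta> \<gamma> d = sorted_list_of_set
     {(i, j, k). int (i + j + k) = d \<and> mono3 (i, j, k) \<notin> ideal_I a b c \<alpha> \<beta> \<gamma>}"

lemma mono3_mult: "mono3 (i, j, k) * mono3 (i', j', k') = mono3 (i + i', j + j', k + k')"
  by (simp add: mono3_def mult_single)

lemma keys_mult_mono3:
  assumes "f \<in> Poly_Mapping.keys (r * mono3 (p, q, t))"
  shows "p \<le> fst f \<and> q \<le> fst (snd f) \<and> t \<le> snd (snd f)"
proof -
  have "f \<in> {u + v |u v. u \<in> Poly_Mapping.keys r \<and> v \<in> Poly_Mapping.keys (mono3 (p, q, t))}"
    using assms keys_mult by blast
  then show ?thesis
    by (auto simp: mono3_def)
qed

lemma mono3_dvd_iff:
  "mono3 (i, j, k) dvd mono3 (i', j', k') \<longleftrightarrow> i \<le> i' \<and> j \<le> j' \<and> k \<le> k'"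
proof
  assume "mono3 (i, j, k) dvd mono3 (i', j', k')"
  then obtain r where "mono3 (i', j', k') = r * mono3 (i, j, k)"
    by (metis dvdE mult.commute)
  then have "(i', j', k') \<in> Poly_Mapping.keys (r * mono3 (i, j, k))"
    by (metis mono3_def keys_single zero_neq_one singletonI)
  from keys_mult_mono3[OF this] show "i \<le> i' \<and> j \<le> j' \<and> k \<le> k'"
    by simp
next
  assume "i \<le> i' \<and> j \<le> j' \<and> k \<le> k'"
  then have "mono3 (i', j', k') = mono3 (i, j, k) * mono3 (i' - i, j' - j, k' - k)"
    by (simp add: mono3_mult)
  then show "mono3 (i, j, k) dvd mono3 (i', j', k')"
    by (rule dvdI)
qed

lemma mono3_in_ideal_iff:
  "mono3 (i, j, k) \<in> ideal_I a b c \<alpha> \<beta> \<gamma> \<longleftrightarrow>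
     a \<le> i \<or> b \<le> j \<or> c \<le> k \<or> (\<alpha> \<le> i \<and> \<beta> \<le> j \<and> \<gamma> \<le> k)"
proof
  define G where "G = {mono3 (a, 0, 0), mono3 (0, b, 0), mono3 (0, 0, c), mono3 (\<alpha>, \<beta>, \<gamma>)}"
  assume "mono3 (i, j, k) \<in> ideal_I a b c \<alpha> \<beta> \<gamma>"
  then have "mono3 (i, j, k) \<in> Modules.module.span (*) G"
    by (simp add: ideal_I_def ideal_gen_def G_def)
  then obtain t r where t: "finite t" "t \<subseteq> G" and eq: "mono3 (i, j, k) = (\<Sum>g\<in>t. r g * g)"
    unfolding module.span_explicit[OF module_poly3] by blast
  have "(i, j, k) \<in> Poly_Mapping.keys (\<Sum>g\<in>t. r g * g)"
    unfolding eq[symmetric] by (simp add: mono3_def)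
  then obtain g where g: "g \<in> t" "(i, j, k) \<in> Poly_Mapping.keys (r g * g)"
    using keys_sum[of "\<lambda>g. r g * g" t] by blast
  have "g \<in> G"
    using g(1) t(2) by blast
  then show "a \<le> i \<or> b \<le> j \<or> c \<le> k \<or> (\<alpha> \<le> i \<and> \<beta> \<le> j \<and> \<gamma> \<le> k)"
    using g(2) by (auto simp: G_def dest!: keys_mult_mono3)
next
  have gen: "mono3 (i, j, k) \<in> ideal_I a b c \<alpha> \<beta> \<gamma>"
    if "g \<in> {mono3 (a, 0, 0), mono3 (0, b, 0), mono3 (0, 0, c), mono3 (\<alpha>, \<beta>, \<gamma>)}"
      "g dvd mono3 (i, j, k)" for g
  proof -
    from that(2) obtain r where "mono3 (i, j, k) = r * g"
      by (metis dvdE mult.commute)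
    then show ?thesis
      using module.span_scale[OF module_poly3 module.span_base[OF module_poly3 that(1)], of r]
      by (simp add: ideal_I_def ideal_gen_def)
  qed
  assume "a \<le> i \<or> b \<le> j \<or> c \<le> k \<or> (\<alpha> \<le> i \<and> \<beta> \<le> j \<and> \<gamma> \<le> k)"
  then show "mono3 (i, j, k) \<in> ideal_I a b c \<alpha> \<beta> \<gamma>"
    using gen[of "mono3 (a, 0, 0)"] gen[of "mono3 (0, b, 0)"] gen[of "mono3 (0, 0, c)"]
      gen[of "mono3 (\<alpha>, \<beta>, \<gamma>)"]
    by (simp add: mono3_dvd_iff) blast
qed

definition Z_mat :: "nat \<Rightarrow> nat \<Rightarrow> nat \<Rightarrow> nat \<Rightarrow> nat \<Rightarrow> nat \<Rightarrow> int mat" where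
  "Z_mat a b c \<alpha> \<beta> \<gamma> =
     (let s = par_s a b c \<alpha> \<beta> \<gamma>;
          m = mons a b c \<alpha> \<beta> \<gamma> s;
          n = mons a b c \<alpha> \<beta> \<gamma> (s + 1)
      in mat (length m) (length n) (\<lambda>(i, j). if mono3 (m ! i) dvd mono3 (n ! j) then 1 else 0))"

definition binom :: "nat \<Rightarrow> int \<Rightarrow> int" where
  "binom n k = (if k < 0 then 0 else int (n choose nat k))"

text \<open>
  Matrix indices start at 0 here, so the condition \<open>1 \<le> i \<le> C\<close> on rows becomes \<open>i < C\<close>;
  the difference \<open>j - i\<close> is unaffected by the shift.
\<close>

definition N_mat :: "nat \<Rightarrow> nat \<Rightarrow> nat \<Rightarrow> nat \<Rightarrow> nat \<Rightarrow> nat \<Rightarrow> int mat" where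
  "N_mat a b c \<alpha> \<beta> \<gamma> =
     (let A = par_A a b c \<alpha> \<beta> \<gamma>;
          C = par_C a b c \<alpha> \<beta> \<gamma>;
          M = par_M a b c \<alpha> \<beta> \<gamma>
      in mat (nat (C + M)) (nat (C + M)) (\<lambda>(i, j).
           if int i < C then binom c (A + int j - int i)
           else binom \<gamma> (A + C - int \<beta> + int j - int i)))"

end

theory Submission
  imports Defs
begin

text \<open>
  Write $R$ for the integer polynomials in $x,y,z$ and $\ell = x+y+z$. Then \<open>Z_mat\<close> is the matrix
  of multiplication by $\ell$ from degree $s$ to degree $s+1$ of $R/I$, so its determinant measures
  the degree $s+1$ part of $R/(I,\ell)$. Setting $z = -(x+y)$ identifies this quotient with
  $\mathbb{Z}[x,y]$ modulo $x^a$, $y^b$, $(x+y)^c$ and $x^\alpha y^\beta (x+y)^\gamma$, and \<open>N_mat\<close>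
  is the matrix of the last two generators, times monomials, in the monomials of degree $s+1$ that
  avoid $x^a$ and $y^b$. So both determinants have as absolute value the order of the same group, if it is finite.

  This comparison of cokernels is carried out by base changes on one larger table. Its columns are
  all monomials of degree $s+1$; its rows are $\ell u$ for the monomials $u$ of degree $s$, together
  with the monomials $v t$ where $v$ is a generator of $I$ and $t$ is a monomial in $x,y$ of the
  right degree. The table can be evaluated in two ways.

  First, separate the monomials inside $I$ from those outside: the table becomes block triangular,
  one block being \<open>Z_mat\<close> (\<open>abs_det_Z_mat\<close>). The other block is unimodular
  (\<open>abs_det_multiples\<close>): the inequalities between the parameters ensure that no two of the
  four generators have a common multiple of degree $s+1$, so that block splits into four copies of
  the base change from the monomials to $\{\ell u\} \cup \{t\}$ (\<open>abs_det_layer\<close>).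

  Second, apply the unimodular column operation that performs $z \mapsto -(x+y)$. It kills the rows
  $\ell u$ in the columns without $z$, and what remains are the coefficients of the substituted
  products $v t$ (\<open>abs_det_eliminate_z\<close>). Combining the two evaluations gives \<open>abs_det_quotient\<close>,
  valid for any monomial ideal whose generators have no common multiples in the degree considered.
  In the case at hand the rows from $x^a$ and $y^b$ are unit vectors, and after removing them and
  their columns \<open>N_mat\<close> is left, up to signs of rows (\<open>abs_det_N_mat\<close>).
\<close>

section \<open>Absolute determinants of tables indexed by finite sets\<close>

definition table :: "('r \<Rightarrow> 'c \<Rightarrow> int) \<Rightarrow> 'r list \<Rightarrow> 'c list \<Rightarrow> int mat" where
  "table f xs ys = mat (length xs) (length ys) (\<lambda>(i, j). f (xs ! i) (ys ! j))"

text \<open>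
  The matrices below are naturally indexed by sets of monomials. Since only absolute values of
  determinants matter, the order of rows and columns is irrelevant, so an arbitrary enumeration of
  both index sets may be used and the two sets may even have different types.
\<close>

definition enumeration :: "'a set \<Rightarrow> 'a list" where
  "enumeration X = (SOME xs. distinct xs \<and> set xs = X)"

definition abs_det :: "('r \<Rightarrow> 'c \<Rightarrow> int) \<Rightarrow> 'r set \<Rightarrow> 'c set \<Rightarrow> int" where
  "abs_det f X Y = \<bar>det (table f (enumeration X) (enumeration Y))\<bar>"

lemma table_carrier: "length xs = n \<Longrightarrow> length ys = m \<Longrightarrow> table f xs ys \<in> carrier_mat n m"
  by (auto simp: table_def)

lemma enumeration:
  assumes "finite X"
  shows "distinct (enumeration X)" "set (enumeration X) = X"
  using someI_ex[of "\<lambda>xs. distinct xs \<and> set xs = X"] finite_distinct_list[OF assms]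
  unfolding enumeration_def by blast+

lemma transpose_table: "transpose_mat (table f xs ys) = table (\<lambda>y x. f x y) ys xs"
  by (rule eq_matI) (auto simp: table_def)

lemma det_table_nonsquare: "length xs \<noteq> length ys \<Longrightarrow> det (table f xs ys) = 0"
  by (simp add: det_def table_def)

text \<open>
  A permutation of the rows multiplies the determinant by its sign. Tables that are not square have
  determinant 0 on both sides.
\<close>

lemma abs_det_table_reorder_rows:
  assumes "mset xs = mset xs'"
  shows "\<bar>det (table f xs ys)\<bar> = \<bar>det (table f xs' ys)\<bar>"
proof (cases "length xs = length ys")
  case True
  obtain p where p: "p permutes {..<length xs'}" "permute_list p xs' = xs"
    using mset_eq_permutation[OF assms] .
  have len: "length xs = length xs'"
    using assms by (rule mset_eq_length)
  have "table f xs ys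
      = mat (length xs') (length xs') (\<lambda>(i, j). table f xs' ys $$ (p i, j))"
  proof (rule eq_matI)
    fix i j assume "i < dim_row (mat (length xs') (length xs') (\<lambda>(i, j). table f xs' ys $$ (p i, j)))"
      "j < dim_col (mat (length xs') (length xs') (\<lambda>(i, j). table f xs' ys $$ (p i, j)))"
    then have ij: "i < length xs'" "j < length xs'"
      by simp_all
    moreover have "p i < length xs'"
      using permutes_in_image[OF p(1), of i] ij(1) by simp
    moreover have "xs ! i = xs' ! p i"
      using permute_list_nth[OF p(1) ij(1)] p(2) by simp
    ultimately show "table f xs ys $$ (i, j)
        = mat (length xs') (length xs') (\<lambda>(i, j). table f xs' ys $$ (p i, j)) $$ (i, j)"
      using True len by (simp add: table_def)
  qed (use True len in \<open>simp_all add: table_def\<close>)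
  moreover have "table f xs' ys \<in> carrier_mat (length xs') (length xs')"
    using True len by (simp add: table_carrier)
  moreover have "p permutes {0..<length xs'}"
    using p(1) by (simp add: atLeast0LessThan)
  ultimately have "det (table f xs ys) = signof p * det (table f xs' ys)"
    using det_permute_rows by metis
  then show ?thesis
    by (simp add: abs_mult sign_def)
next
  case False
  then show ?thesis
    using det_table_nonsquare[of xs ys f] det_table_nonsquare[of xs' ys f]
      mset_eq_length[OF assms] by simp
qed

lemma abs_det_table_transpose:
  "\<bar>det (table f xs ys)\<bar> = \<bar>det (table (\<lambda>y x. f x y) ys xs)\<bar>"
proof (cases "length xs = length ys")
  case True
  then have "table f xs ys \<in> carrier_mat (length xs) (length xs)"
    by (simp add: table_def)
  from det_transpose[OF this] show ?thesis
    by (simp add: transpose_table)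
qed (simp add: det_table_nonsquare)

lemma abs_det_table_reorder:
  assumes "mset xs = mset xs'" "mset ys = mset ys'"
  shows "\<bar>det (table f xs ys)\<bar> = \<bar>det (table f xs' ys')\<bar>"
  using abs_det_table_reorder_rows[OF assms(1), of f ys]
    abs_det_table_reorder_rows[OF assms(2), of "\<lambda>y x. f x y" xs']
  by (simp add: abs_det_table_transpose[of f])

lemma abs_det_eq:
  assumes "distinct xs" "distinct ys"
  shows "abs_det f (set xs) (set ys) = \<bar>det (table f xs ys)\<bar>"
  unfolding abs_det_def
  by (rule abs_det_table_reorder)
    (simp_all add: assms enumeration set_eq_iff_mset_eq_distinct[symmetric])

lemma abs_det_nonsquare:
  assumes "finite X" "finite Y" "card X \<noteq> card Y"
  shows "abs_det f X Y = 0"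
  unfolding abs_det_def
  by (metis abs_zero assms det_table_nonsquare distinct_card enumeration)

lemma abs_det_cong:
  assumes "finite X" "finite Y" "\<And>x y. x \<in> X \<Longrightarrow> y \<in> Y \<Longrightarrow> f x y = g x y"
  shows "abs_det f X Y = abs_det g X Y"
proof -
  have "table f (enumeration X) (enumeration Y) = table g (enumeration X) (enumeration Y)"
    using assms(3) nth_mem[of _ "enumeration X"] nth_mem[of _ "enumeration Y"]
      enumeration(2)[OF assms(1)] enumeration(2)[OF assms(2)]
    by (intro eq_matI) (simp_all add: table_def)
  then show ?thesis
    by (simp add: abs_det_def)
qed

text \<open>
  It suffices that one of the diagonal blocks is square: if the other is not, then neither is the
  whole table, and both sides vanish.
\<close>

lemma abs_det_block:
  assumes fin: "finite X1" "finite X2" "finite Y1" "finite Y2"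
    and disj: "X1 \<inter> X2 = {}" "Y1 \<inter> Y2 = {}"
    and card: "card X1 = card Y1 \<or> card X2 = card Y2"
    and zero: "\<And>x y. x \<in> X2 \<Longrightarrow> y \<in> Y1 \<Longrightarrow> f x y = 0"
  shows "abs_det f (X1 \<union> X2) (Y1 \<union> Y2) = abs_det f X1 Y1 * abs_det f X2 Y2"
proof (cases "card X1 = card Y1 \<and> card X2 = card Y2")
  case True
  obtain xs1 xs2 ys1 ys2 where
    e: "distinct xs1" "distinct xs2" "distinct ys1" "distinct ys2"
      "set xs1 = X1" "set xs2 = X2" "set ys1 = Y1" "set ys2 = Y2"
    using fin by (metis finite_distinct_list)
  have len: "length ys1 = length xs1" "length ys2 = length xs2"
    using e True by (metis distinct_card)+
  have eq: "table f (xs1 @ xs2) (ys1 @ ys2) = four_block_mat (table f xs1 ys1) (table f xs1 ys2)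
      (0\<^sub>m (length xs2) (length xs1)) (table f xs2 ys2)"
    using zero e(6,7) len
    by (intro eq_matI) (auto simp: table_def nth_append)
  have "abs_det f (set (xs1 @ xs2)) (set (ys1 @ ys2)) = \<bar>det (table f (xs1 @ xs2) (ys1 @ ys2))\<bar>"
    using e disj by (intro abs_det_eq) auto
  also have "det (table f (xs1 @ xs2) (ys1 @ ys2)) = det (table f xs1 ys1) * det (table f xs2 ys2)"
    unfolding eq
    by (rule det_four_block_mat_lower_left_zero[OF table_carrier table_carrier refl table_carrier])
      (simp_all only: len)
  finally show ?thesis
    using abs_det_eq[of xs1 ys1 f] abs_det_eq[of xs2 ys2 f] e by (simp add: abs_mult)
next
  case False
  then have "card (X1 \<union> X2) \<noteq> card (Y1 \<union> Y2)"
    using card fin disj by (auto simp: card_Un_disjoint)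
  then show ?thesis
    using False fin by (auto simp: abs_det_nonsquare)
qed

lemma abs_det_block_diagonal:
  assumes fin: "finite V" "\<And>v. v \<in> V \<Longrightarrow> finite (X v)" "\<And>v. v \<in> V \<Longrightarrow> finite (Y v)"
    and disj: "\<And>v w. v \<in> V \<Longrightarrow> w \<in> V \<Longrightarrow> v \<noteq> w \<Longrightarrow> X v \<inter> X w = {} \<and> Y v \<inter> Y w = {}"
    and card: "\<And>v. v \<in> V \<Longrightarrow> card (X v) = card (Y v)"
    and zero: "\<And>v w x y. v \<in> V \<Longrightarrow> w \<in> V \<Longrightarrow> v \<noteq> w \<Longrightarrow> x \<in> X v \<Longrightarrow> y \<in> Y w \<Longrightarrow> f x y = 0"
  shows "abs_det f (\<Union>v\<in>V. X v) (\<Union>v\<in>V. Y v) = (\<Prod>v\<in>V. abs_det f (X v) (Y v))"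
  using assms
proof (induction V rule: finite_induct)
  case empty
  then show ?case
    using abs_det_eq[of "[]" "[]" f] by (simp add: table_def det_def)
next
  case (insert v V)
  have "X v \<inter> (\<Union>w\<in>V. X w) = {}" "Y v \<inter> (\<Union>w\<in>V. Y w) = {}"
    using insert.prems(3) insert.hyps(2) by blast+
  moreover have "f x y = 0" if "x \<in> (\<Union>w\<in>V. X w)" "y \<in> Y v" for x y
    using that insert.prems(5) insert.hyps(2) by blast
  moreover have "abs_det f (\<Union>w\<in>V. X w) (\<Union>w\<in>V. Y w) = (\<Prod>w\<in>V. abs_det f (X w) (Y w))"
  proof (rule insert.IH)
    show "f x y = 0" if "v \<in> V" "w \<in> V" "v \<noteq> w" "x \<in> X v" "y \<in> Y w" for v w x y
      using insert.prems(5)[of v w x y] that by simp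
  qed (use insert.prems(1-4) in simp_all)
  ultimately have "abs_det f (X v \<union> (\<Union>w\<in>V. X w)) (Y v \<union> (\<Union>w\<in>V. Y w))
      = abs_det f (X v) (Y v) * (\<Prod>w\<in>V. abs_det f (X w) (Y w))"
    using insert.hyps(1) insert.prems(1,2,4)
      abs_det_block[of "X v" "\<Union>w\<in>V. X w" "Y v" "\<Union>w\<in>V. Y w" f] by auto
  then show ?case
    using insert.hyps by simp
qed

text \<open>
  Listing \<open>X\<close> by increasing values of \<open>\<kappa>\<close>, and the columns in the matching order, makes the table
  lower triangular with units on the diagonal.
\<close>

lemma abs_det_triangular:
  fixes \<kappa> :: "'r \<Rightarrow> nat"
  assumes fin: "finite X" and inj: "inj_on h X"
    and diag: "\<And>x. x \<in> X \<Longrightarrow> \<bar>f x (h x)\<bar> = 1"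
    and zero: "\<And>x x'. x \<in> X \<Longrightarrow> x' \<in> X \<Longrightarrow> x \<noteq> x' \<Longrightarrow> \<kappa> x \<le> \<kappa> x' \<Longrightarrow> f x (h x') = 0"
  shows "abs_det f X (h ` X) = 1"
proof -
  obtain xs0 where xs0: "distinct xs0" "set xs0 = X"
    using fin finite_distinct_list by blast
  define xs where "xs = sort_key \<kappa> xs0"
  have xs: "distinct xs" "set xs = X" "sorted (map \<kappa> xs)"
    by (simp_all add: xs_def xs0)
  have entry: "table f xs (map h xs) $$ (i, j) = f (xs ! i) (h (xs ! j))"
    if "i < length xs" "j < length xs" for i j
    using that by (simp add: table_def)
  have carrier: "table f xs (map h xs) \<in> carrier_mat (length xs) (length xs)"
    by (simp add: table_def)
  have "table f xs (map h xs) $$ (i, j) = 0" if "i < j" "j < length xs" for i j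
  proof -
    have "\<kappa> (xs ! i) \<le> \<kappa> (xs ! j)"
      using sorted_nth_mono[OF xs(3), of i j] that by simp
    moreover have "xs ! i \<noteq> xs ! j"
      using that xs(1) by (simp add: nth_eq_iff_index_eq)
    ultimately show ?thesis
      using that zero[of "xs ! i" "xs ! j"] xs(2) by (auto simp: entry)
  qed
  from det_lower_triangular[OF this carrier]
  have "det (table f xs (map h xs)) = (\<Prod>i<length xs. f (xs ! i) (h (xs ! i)))"
    using carrier by (simp add: prod_list_diag_prod entry atLeast0LessThan)
  then have "\<bar>det (table f xs (map h xs))\<bar> = (\<Prod>i<length xs. \<bar>f (xs ! i) (h (xs ! i))\<bar>)"
    by (simp add: abs_prod)
  also have "\<dots> = 1"
    using diag xs(2) by (intro prod.neutral) auto
  finally show ?thesis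
    using abs_det_eq[of xs "map h xs" f] xs inj by (simp add: distinct_map)
qed

lemma abs_det_mult:
  assumes fin: "finite X" "finite Y" "finite Z" and card: "card Y = card Z"
  shows "abs_det (\<lambda>x z. \<Sum>y\<in>Y. f x y * g y z) X Z = abs_det f X Y * abs_det g Y Z"
proof (cases "card X = card Y")
  case True
  obtain xs ys zs where e: "distinct xs" "distinct ys" "distinct zs"
      "set xs = X" "set ys = Y" "set zs = Z"
    using fin by (metis finite_distinct_list)
  have len: "length ys = length xs" "length zs = length xs"
    using e True card by (metis distinct_card)+
  have "(\<Sum>y\<in>Y. f x y * g y z) = (\<Sum>j<length ys. f x (ys ! j) * g (ys ! j) z)" for x z
    using e(2,5) sum_list_distinct_conv_sum_set[OF e(2), of "\<lambda>y. f x y * g y z"]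
    by (simp add: sum_list_sum_nth atLeast0LessThan)
  then have "table (\<lambda>x z. \<Sum>y\<in>Y. f x y * g y z) xs zs = table f xs ys * table g ys zs"
    by (intro eq_matI) (auto simp: table_def scalar_prod_def atLeast0LessThan)
  moreover have "det (table f xs ys * table g ys zs) = det (table f xs ys) * det (table g ys zs)"
    by (rule det_mult[of _ "length xs"]) (simp_all add: table_carrier len)
  ultimately show ?thesis
    using e abs_det_eq[of xs ys f] abs_det_eq[of ys zs g]
      abs_det_eq[of xs zs "\<lambda>x z. \<Sum>y\<in>Y. f x y * g y z"]
    by (simp add: abs_mult)
next
  case False
  then show ?thesis
    using fin card by (simp add: abs_det_nonsquare)
qed

text \<open>
  Scaling rows is multiplication from the left by a diagonal table, whose determinant is a unit.
\<close>

lemma abs_det_scale_rows: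
  assumes fin: "finite X" "finite Y" and unit: "\<And>x. x \<in> X \<Longrightarrow> \<bar>e x\<bar> = 1"
  shows "abs_det (\<lambda>x y. e x * f x y) X Y = abs_det f X Y"
proof (cases "card X = card Y")
  case True
  have "abs_det (\<lambda>x y. e x * f x y) X Y
      = abs_det (\<lambda>x y. \<Sum>x'\<in>X. (if x' = x then e x else 0) * f x' y) X Y"
    using fin by (intro abs_det_cong) (simp_all add: if_distrib[of "\<lambda>c. c * _"] cong: if_cong)
  also have "\<dots> = abs_det (\<lambda>x x'. if x' = x then e x else 0) X X * abs_det f X Y"
    using fin True by (intro abs_det_mult)
  also have "abs_det (\<lambda>x x'. if x' = x then e x else 0) X X = 1"
    using abs_det_triangular[of X id "\<lambda>x x'. if x' = x then e x else 0" "\<lambda>_. 0"] fin unit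
    by simp
  finally show ?thesis
    by simp
qed (simp add: fin abs_det_nonsquare)

lemma abs_det_reindex:
  assumes fin: "finite X" "finite Y" and inj: "inj_on g X" "inj_on h Y"
    and eq: "\<And>x y. x \<in> X \<Longrightarrow> y \<in> Y \<Longrightarrow> f' (g x) (h y) = f x y"
  shows "abs_det f' (g ` X) (h ` Y) = abs_det f X Y"
proof -
  obtain xs ys where e: "distinct xs" "distinct ys" "set xs = X" "set ys = Y"
    using fin by (metis finite_distinct_list)
  have "table f' (map g xs) (map h ys) = table f xs ys"
    using eq e(3,4) by (intro eq_matI) (auto simp: table_def)
  then show ?thesis
    using abs_det_eq[of "map g xs" "map h ys" f'] abs_det_eq[of xs ys f] e inj
    by (simp add: distinct_map)
qed

section \<open>Monomials of a fixed degree\<close>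

(* Otherwise simp turns the 1 in n - 1 and (0, 0, 1) into Suc 0. *)
declare One_nat_def [simp del]

type_synonym monomial = "nat \<times> nat \<times> nat"

fun deg :: "monomial \<Rightarrow> nat" where
  "deg (i, j, k) = i + j + k"

fun divides :: "monomial \<Rightarrow> monomial \<Rightarrow> bool" where
  "divides (i, j, k) (i', j', k') \<longleftrightarrow> i \<le> i' \<and> j \<le> j' \<and> k \<le> k'"

definition incidence :: "monomial \<Rightarrow> monomial \<Rightarrow> int" where
  "incidence u v = of_bool (divides u v)"

text \<open>
  The monomials of degree \<open>n - 1\<close>. With this shift \<open>layer 0\<close> is empty, as it should be for degree
  \<open>-1\<close>, and the cofactors of \<open>v\<close> in the multiples of \<open>v\<close> in \<open>layer n\<close> are \<open>layer (n - deg v)\<close> even if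
  the subtraction truncates.
\<close>

definition layer :: "nat \<Rightarrow> monomial set" where
  "layer n = {m. Suc (deg m) = n}"

definition z_free :: "nat \<Rightarrow> monomial set" where
  "z_free n = {m \<in> layer n. snd (snd m) = 0}"

definition multiples :: "monomial set \<Rightarrow> monomial set" where
  "multiples G = {m. \<exists>v\<in>G. divides v m}"

text \<open>
  For a monomial $x^i y^j z^k$ and a monomial $x^p y^q$ of the same degree, this is the coefficient
  of the latter in the image $x^i y^j (-x-y)^k$ of the former under $z \mapsto -(x+y)$. The degrees
  being equal, \<open>q\<close> alone determines the coefficient.
\<close>

fun subst_coeff :: "monomial \<Rightarrow> monomial \<Rightarrow> int" where
  "subst_coeff (i, j, k) (p, q, r) = (-1) ^ k * binom k (int q - int j)"

lemma deg_add [simp]: "deg (u + v) = deg u + deg v"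
  by (cases u; cases v) simp

lemma divides_iff_add: "divides u v \<longleftrightarrow> (\<exists>w. v = u + w)"
proof
  assume "divides u v"
  then have "v = u + (fst v - fst u, fst (snd v) - fst (snd u), snd (snd v) - snd (snd u))"
    by (cases u; cases v) simp
  then show "\<exists>w. v = u + w" ..
qed (cases u; cases v; auto)

lemma divides_add [simp]: "divides u (u + w)"
  using divides_iff_add by blast

lemma divides_refl [simp]: "divides u u"
  by (cases u) simp

lemma divides_trans: "divides u v \<Longrightarrow> divides v w \<Longrightarrow> divides u w"
  by (cases u; cases v; cases w) auto

lemma divides_cancel [simp]: "divides (v + u) (v + w) \<longleftrightarrow> divides u w"
  by (cases u; cases v; cases w) auto

lemma divides_same_deg: "divides u v \<Longrightarrow> deg u = deg v \<Longrightarrow> u = v"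
  by (cases u; cases v) auto

lemma finite_layer [simp]: "finite (layer n)"
proof (rule finite_subset)
  show "layer n \<subseteq> {..n} \<times> {..n} \<times> {..n}"
    by (auto simp: layer_def)
qed simp

lemma finite_z_free [simp]: "finite (z_free n)"
  by (simp add: z_free_def)

lemma layer_split: "layer n = z_free n \<union> (+) (0, 0, 1) ` layer (n - 1)"
proof -
  have "m \<in> (+) (0, 0, 1) ` layer (n - 1)" if "m \<in> layer n" "m \<notin> z_free n" for m
  proof -
    obtain i j k where m: "m = (i, j, k)"
      by (metis surj_pair)
    then have "k > 0"
      using that by (auto simp: z_free_def)
    then have "m = (0, 0, 1) + (i, j, k - 1)" "(i, j, k - 1) \<in> layer (n - 1)"
      using that(1) m by (auto simp: layer_def)
    then show ?thesis
      by blast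
  qed
  then show ?thesis
    by (auto simp: z_free_def layer_def)
qed

lemma z_free_Int_shift [simp]:
  "z_free n \<inter> (+) (0, 0, 1) ` X = {}" "(+) (0, 0, 1) ` X \<inter> z_free n = {}"
  by (auto simp: z_free_def)

lemma inj_on_add [simp]: "inj_on ((+) (v :: monomial)) X"
  by (cases v) (auto simp: inj_on_def)

lemma layer_pred_Int_z_free [simp]: "layer (n - 1) \<inter> z_free n = {}" "z_free n \<inter> layer (n - 1) = {}"
  by (auto simp: z_free_def layer_def)

lemma card_layer: "card (layer n) = card (layer (n - 1) \<union> z_free n)"
  by (subst layer_split) (simp add: card_Un_disjoint card_image)

text \<open>
  Multiplication by $x+y+z$ followed by the projection onto the multiples of $z$: the term $zu$ of
  $(x+y+z)u$ gives the diagonal, and the terms $xu$, $yu$ have a smaller exponent of $z$ than $zu$.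
\<close>

lemma abs_det_z_shift: "abs_det incidence (layer n) ((+) (0, 0, 1) ` layer n) = 1"
proof (rule abs_det_triangular)
  fix u v assume uv: "u \<in> layer n" "v \<in> layer n" "u \<noteq> v" "snd (snd u) \<le> snd (snd v)"
  obtain i j k i' j' k' where "u = (i, j, k)" "v = (i', j', k')"
    by (metis surj_pair)
  then show "incidence u ((0, 0, 1) + v) = 0"
    using uv by (auto simp: incidence_def layer_def)
next
  fix u assume "u \<in> layer n"
  show "\<bar>incidence u ((0, 0, 1) + u)\<bar> = 1"
    using divides_add[of u "(0, 0, 1)"] by (simp add: incidence_def add.commute)
qed simp_all

lemma abs_det_z_free:
  assumes "X \<subseteq> z_free n"
  shows "abs_det subst_coeff X X = 1" "abs_det incidence X X = 1"
proof -
  have fin: "finite X"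
    using assms finite_z_free by (rule finite_subset)
  have "abs_det subst_coeff X (id ` X) = 1"
  proof (rule abs_det_triangular[where \<kappa> = "\<lambda>_. 0"])
    fix u v assume uv: "u \<in> X" "v \<in> X"
    obtain i j k p q r where eq: "u = (i, j, k)" "v = (p, q, r)"
      by (metis surj_pair)
    have "u \<in> z_free n" "v \<in> z_free n"
      using uv assms by auto
    then have "k = 0" "r = 0" "i + j = p + q"
      by (auto simp: eq z_free_def layer_def)
    then show "u \<noteq> v \<Longrightarrow> subst_coeff u (id v) = 0"
      by (auto simp: eq binom_def)
  next
    fix u assume "u \<in> X"
    then show "\<bar>subst_coeff u (id u)\<bar> = 1"
      by (cases u) (simp add: binom_def abs_mult power_abs)
  qed (use fin in simp_all)
  then show "abs_det subst_coeff X X = 1"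
    by simp
  have "abs_det incidence X (id ` X) = 1"
  proof (rule abs_det_triangular[where \<kappa> = "\<lambda>_. 0"])
    fix u v assume "u \<in> X" "v \<in> X" "u \<noteq> v"
    then show "incidence u (id v) = 0"
      using assms divides_same_deg[of u v] by (auto simp: incidence_def z_free_def layer_def)
  qed (use fin in \<open>simp_all add: incidence_def\<close>)
  then show "abs_det incidence X X = 1"
    by simp
qed

text \<open>
  The multiples of $x+y+z$ and the monomials without $z$ together form a basis of the forms of
  degree \<open>n - 1\<close>. The corresponding base change has determinant $\pm 1$.
\<close>

lemma abs_det_layer: "abs_det incidence (layer (n - 1) \<union> z_free n) (layer n) = 1"
proof -
  have "abs_det incidence (layer (n - 1) \<union> z_free n) ((+) (0, 0, 1) ` layer (n - 1) \<union> z_free n)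
      = abs_det incidence (layer (n - 1)) ((+) (0, 0, 1) ` layer (n - 1))
        * abs_det incidence (z_free n) (z_free n)"
  proof (rule abs_det_block)
    fix u v assume uv: "u \<in> z_free n" "v \<in> (+) (0, 0, 1) ` layer (n - 1)"
    then have "deg u = deg v" "u \<noteq> v"
      by (auto simp: z_free_def layer_def)
    then show "incidence u v = 0"
      using divides_same_deg[of u v] by (auto simp: incidence_def)
  qed (simp_all add: Int_commute card_image card_layer)
  then show ?thesis
    using layer_split[of n] by (simp add: abs_det_z_shift abs_det_z_free[OF subset_refl] Un_commute)
qed

section \<open>Eliminating \<open>z\<close> modulo a monomial ideal\<close>

lemma incidence_add [simp]: "incidence (v + u) (v + w) = incidence u w"
  by (simp add: incidence_def)

lemma layer_Int_multiples:
  "layer n \<inter> multiples G = (\<Union>v\<in>G. (+) v ` layer (n - deg v))"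
proof -
  have "m \<in> layer n \<and> divides v m \<longleftrightarrow> m \<in> (+) v ` layer (n - deg v)" for m v
    unfolding divides_iff_add layer_def image_iff by fastforce
  then show ?thesis
    unfolding multiples_def by blast
qed

text \<open>
  In the degrees at hand the ideal generated by \<open>G\<close> is the direct sum of the principal ideals of
  the generators, as no monomial is a multiple of two of them. On each summand, division by the
  generator reduces the claim to the base change of \<open>abs_det_layer\<close>.
\<close>

lemma abs_det_multiples:
  assumes fin: "finite G"
    and lcm: "\<And>u v m. u \<in> G \<Longrightarrow> v \<in> G \<Longrightarrow> u \<noteq> v \<Longrightarrow> divides u m \<Longrightarrow> divides v m \<Longrightarrow> n \<le> deg m"
  defines "E \<equiv> \<Union>v\<in>G. (+) v ` z_free (n - deg v)"
  shows "abs_det incidence ((layer (n - 1) \<inter> multiples G) \<union> E) (layer n \<inter> multiples G) = 1"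
    "card ((layer (n - 1) \<inter> multiples G) \<union> E) = card (layer n \<inter> multiples G)"
proof -
  define X where "X v = (+) v ` (layer (n - deg v - 1) \<union> z_free (n - deg v))" for v :: monomial
  define Y where "Y v = (+) v ` layer (n - deg v)" for v :: monomial
  have rows: "(layer (n - 1) \<inter> multiples G) \<union> E = (\<Union>v\<in>G. X v)"
    unfolding X_def E_def layer_Int_multiples image_Un diff_commute[of n 1] by blast
  have cols: "layer n \<inter> multiples G = (\<Union>v\<in>G. Y v)"
    by (simp add: Y_def layer_Int_multiples)
  have X: "divides v m \<and> deg m < n" if "m \<in> X v" for v m
    using that by (auto simp: X_def layer_def z_free_def)
  have Y: "divides v m \<and> deg m < n" if "m \<in> Y v" for v m
    using that by (auto simp: Y_def layer_def)
  have disj: "X v \<inter> X w = {} \<and> Y v \<inter> Y w = {}" if "v \<in> G" "w \<in> G" "v \<noteq> w" for v w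
    using lcm[OF that] X Y by (meson disjoint_iff not_le)
  have fin_XY: "finite (X v)" "finite (Y v)" for v
    by (simp_all add: X_def Y_def)
  have card: "card (X v) = card (Y v)" for v
    by (simp add: X_def Y_def card_image card_layer[of "n - deg v"])
  have "abs_det incidence (X v) (Y v) = 1" for v
    unfolding X_def Y_def
    by (subst abs_det_reindex[where f = incidence]) (simp_all add: abs_det_layer del: diff_diff_left)
  moreover have "incidence x y = 0" if "v \<in> G" "w \<in> G" "v \<noteq> w" "x \<in> X v" "y \<in> Y w" for v w x y
    using lcm[OF that(1-3), of y] X[OF that(4)] Y[OF that(5)] divides_trans[of v x y]
    by (auto simp: incidence_def)
  ultimately show "abs_det incidence ((layer (n - 1) \<inter> multiples G) \<union> E) (layer n \<inter> multiples G) = 1"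
    unfolding rows cols using fin fin_XY disj card
    by (subst abs_det_block_diagonal) simp_all
  show "card ((layer (n - 1) \<inter> multiples G) \<union> E) = card (layer n \<inter> multiples G)"
    unfolding rows cols using fin fin_XY disj card by (simp add: card_UN_disjoint)
qed

lemma binom_Suc: "binom (Suc k) i = binom k i + binom k (i - 1)"
proof (cases "0 < i")
  case True
  then obtain l where "i = int (Suc l)"
    by (metis zero_less_imp_eq_int gr0_implies_Suc)
  then show ?thesis
    by (simp add: binom_def nat_add_distrib)
next
  case False
  then show ?thesis
    by (cases "i = 0") (simp_all add: binom_def)
qed

text \<open>
  The substitution kills the multiples of $x+y+z$; on coefficients this is Pascal's rule.
\<close>

lemma subst_coeff_linear_form:
  "subst_coeff ((1, 0, 0) + u) t + subst_coeff ((0, 1, 0) + u) t + subst_coeff ((0, 0, 1) + u) t = 0"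
proof -
  obtain i j k p q r where "u = (i, j, k)" "t = (p, q, r)"
    by (metis surj_pair)
  then show ?thesis
    by (simp add: binom_Suc[unfolded Suc_eq_plus1_left] power_add algebra_simps)
qed

lemma layer_above:
  assumes "u \<in> layer (n - 1)"
  shows "{m \<in> layer n. divides u m} = {(1, 0, 0) + u, (0, 1, 0) + u, (0, 0, 1) + u}"
proof -
  obtain i j k where u: "u = (i, j, k)"
    by (metis surj_pair)
  have "m \<in> {(1, 0, 0) + u, (0, 1, 0) + u, (0, 0, 1) + u}" if "m \<in> layer n" "divides u m" for m
    using that assms by (cases m) (auto simp: u layer_def)
  then show ?thesis
    using assms by (auto simp: u layer_def)
qed

text \<open>
  Right multiplication by \<open>W\<close> turns the column of a monomial $t$ without $z$ into the coefficient
  of $t$ after the substitution $z \mapsto -(x+y)$ and keeps the other columns. The rows of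
  \<open>layer (n - 1)\<close> stand for multiples of $x+y+z$ and thus vanish in the new columns; in the old
  ones they form the unitriangular block of \<open>abs_det_z_shift\<close>.
\<close>

lemma abs_det_eliminate_z:
  assumes E: "E \<subseteq> layer n"
  shows "abs_det incidence (layer (n - 1) \<union> E) (layer n) = abs_det subst_coeff E (z_free n)"
proof -
  define W where "W m t = (if t \<in> z_free n then subst_coeff m t else of_bool (m = t))" for m t
  let ?P = "\<lambda>u t. \<Sum>m\<in>layer n. incidence u m * W m t"
  have finE: "finite E"
    using E by (rule finite_subset) simp
  \<comment> \<open>\<open>W\<close> is unitriangular with respect to the exponent of $z$.\<close>
  have "abs_det W (layer n) (id ` layer n) = 1"
  proof (rule abs_det_triangular[where \<kappa> = "\<lambda>m. snd (snd m)"])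
    fix u v assume uv: "u \<in> layer n" "v \<in> layer n" "u \<noteq> v" "snd (snd u) \<le> snd (snd v)"
    obtain i j k p q r where "u = (i, j, k)" "v = (p, q, r)"
      by (metis surj_pair)
    then show "W u (id v) = 0"
      using uv by (auto simp: W_def z_free_def layer_def binom_def)
  next
    fix u assume "u \<in> layer n"
    then show "\<bar>W u (id u)\<bar> = 1"
      by (cases u) (simp add: W_def binom_def abs_mult power_abs)
  qed simp_all
  then have "abs_det incidence (layer (n - 1) \<union> E) (layer n) = abs_det ?P (layer (n - 1) \<union> E) (layer n)"
    using finE by (simp add: abs_det_mult)
  also have "\<dots> = abs_det ?P (E \<union> layer (n - 1)) (z_free n \<union> (+) (0, 0, 1) ` layer (n - 1))"
    using layer_split[of n] by (simp add: Un_commute)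
  also have "\<dots> = abs_det ?P E (z_free n) * abs_det ?P (layer (n - 1)) ((+) (0, 0, 1) ` layer (n - 1))"
  proof (rule abs_det_block)
    show "E \<inter> layer (n - 1) = {}"
      using E by (auto simp: layer_def)
    fix u t assume ut: "u \<in> layer (n - 1)" "t \<in> z_free n"
    have "?P u t = (\<Sum>m\<in>{m \<in> layer n. divides u m}. subst_coeff m t)"
      using ut(2) by (intro sum.mono_neutral_cong_right) (auto simp: W_def incidence_def)
    also have "\<dots> = 0"
      using subst_coeff_linear_form[of u t] unfolding layer_above[OF ut(1)]
      by (cases u) (simp add: add.assoc)
    finally show "?P u t = 0" .
  qed (use finE in \<open>simp_all add: card_image\<close>)
  also have "abs_det ?P E (z_free n) = abs_det subst_coeff E (z_free n)"
  proof (rule abs_det_cong)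
    fix u t assume ut: "u \<in> E" "t \<in> z_free n"
    then have "u \<in> layer n"
      using E by blast
    have "?P u t = (\<Sum>m\<in>{u}. subst_coeff m t)"
    proof (rule sum.mono_neutral_cong_right)
      show "\<forall>m\<in>layer n - {u}. incidence u m * W m t = 0"
        using \<open>u \<in> layer n\<close> divides_same_deg[of u] unfolding incidence_def layer_def by fastforce
    qed (use ut(2) \<open>u \<in> layer n\<close> in \<open>simp_all add: W_def incidence_def\<close>)
    then show "?P u t = subst_coeff u t"
      by simp
  qed (use finE in simp_all)
  also have "abs_det ?P (layer (n - 1)) ((+) (0, 0, 1) ` layer (n - 1))
      = abs_det incidence (layer (n - 1)) ((+) (0, 0, 1) ` layer (n - 1))"
  proof (rule abs_det_cong)
    fix u t assume ut: "u \<in> layer (n - 1)" "t \<in> (+) (0, 0, 1) ` layer (n - 1)"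
    then have t: "t \<in> layer n" "t \<notin> z_free n"
      using layer_split[of n] z_free_Int_shift(1)[of n "layer (n - 1)"] by blast+
    have "?P u t = (\<Sum>m\<in>{t}. incidence u m)"
      using t by (intro sum.mono_neutral_cong_right) (auto simp: W_def)
    then show "?P u t = incidence u t"
      by simp
  qed simp_all
  finally show ?thesis
    by (simp add: abs_det_z_shift)
qed

text \<open>
  Both sides are, up to sign, the determinant of the table with rows \<open>layer (n - 1) \<union> E\<close> and
  columns \<open>layer n\<close>, where \<open>E\<close> consists of the products of the generators with monomials
  without $z$. Separating the monomials in the ideal from the others gives the left hand side times
  the unimodular table of \<open>abs_det_multiples\<close>; eliminating $z$ gives the right hand side. In terms
  of modules: the cokernel of multiplication by $x+y+z$ on the quotient by the ideal is presented
  by the images of the generators in the polynomials in $x$ and $y$.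
\<close>

lemma abs_det_quotient:
  assumes fin: "finite G"
    and lcm: "\<And>u v m. u \<in> G \<Longrightarrow> v \<in> G \<Longrightarrow> u \<noteq> v \<Longrightarrow> divides u m \<Longrightarrow> divides v m \<Longrightarrow> n \<le> deg m"
  shows "abs_det incidence (layer (n - 1) - multiples G) (layer n - multiples G)
    = abs_det subst_coeff (\<Union>v\<in>G. (+) v ` z_free (n - deg v)) (z_free n)"
proof -
  define E where "E = (\<Union>v\<in>G. (+) v ` z_free (n - deg v))"
  have E: "E \<subseteq> layer n \<inter> multiples G"
    unfolding E_def layer_Int_multiples by (auto simp: z_free_def)
  have finE: "finite E"
    using fin by (simp add: E_def)
  have "abs_det subst_coeff E (z_free n) = abs_det incidence (layer (n - 1) \<union> E) (layer n)"
    using E by (simp add: abs_det_eliminate_z)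
  also have "\<dots> = abs_det incidence ((layer (n - 1) - multiples G) \<union> ((layer (n - 1) \<inter> multiples G) \<union> E))
      ((layer n - multiples G) \<union> (layer n \<inter> multiples G))"
    by (rule arg_cong2[of _ _ _ _ "abs_det incidence"]) auto
  also have "\<dots> = abs_det incidence (layer (n - 1) - multiples G) (layer n - multiples G)
      * abs_det incidence ((layer (n - 1) \<inter> multiples G) \<union> E) (layer n \<inter> multiples G)"
  proof (rule abs_det_block)
    show "card (layer (n - 1) - multiples G) = card (layer n - multiples G)
      \<or> card ((layer (n - 1) \<inter> multiples G) \<union> E) = card (layer n \<inter> multiples G)"
      unfolding E_def by (rule disjI2, rule abs_det_multiples(2)[OF fin lcm])
    fix u m assume "u \<in> (layer (n - 1) \<inter> multiples G) \<union> E" "m \<in> layer n - multiples G"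
    then have "u \<in> multiples G" "m \<notin> multiples G"
      using E by auto
    then show "incidence u m = 0"
      using divides_trans[of _ u m] unfolding incidence_def multiples_def by auto
  qed (use E finE in auto)
  also have "abs_det incidence ((layer (n - 1) \<inter> multiples G) \<union> E) (layer n \<inter> multiples G) = 1"
    unfolding E_def using fin lcm by (rule abs_det_multiples(1))
  finally show ?thesis
    by (simp add: E_def)
qed

section \<open>The two matrices of the theorem\<close>

lemma abs_det_Z_mat:
  assumes n: "3 * n = a + b + c + \<alpha> + \<beta> + \<gamma>" "0 < n"
  defines "G \<equiv> {(a, 0, 0), (0, b, 0), (0, 0, c), (\<alpha>, \<beta>, \<gamma>)}"
  shows "\<bar>det (Z_mat a b c \<alpha> \<beta> \<gamma>)\<bar>
    = abs_det incidence (layer (n - 1) - multiples G) (layer n - multiples G)"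
proof -
  have mons: "distinct (mons a b c \<alpha> \<beta> \<gamma> d)" "set (mons a b c \<alpha> \<beta> \<gamma> d) = layer k - multiples G"
    if "d = int k - 1" for d k
  proof -
    have "{(i, j, l). int (i + j + l) = d \<and> mono3 (i, j, l) \<notin> ideal_I a b c \<alpha> \<beta> \<gamma>}
        = layer k - multiples G"
      using that by (auto simp: layer_def multiples_def G_def mono3_in_ideal_iff)
    then show "distinct (mons a b c \<alpha> \<beta> \<gamma> d)" "set (mons a b c \<alpha> \<beta> \<gamma> d) = layer k - multiples G"
      by (simp_all add: mons_def)
  qed
  define s where "s = par_s a b c \<alpha> \<beta> \<gamma>"
  have s: "s = int (n - 1) - 1" "s + 1 = int n - 1"
    using n unfolding s_def par_s_def by linarith+
  have "(if mono3 u dvd mono3 v then 1 else 0) = incidence u v" for u v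
    by (cases u; cases v) (simp add: incidence_def mono3_dvd_iff)
  then have "Z_mat a b c \<alpha> \<beta> \<gamma> = table incidence (mons a b c \<alpha> \<beta> \<gamma> s) (mons a b c \<alpha> \<beta> \<gamma> (s + 1))"
    by (simp add: Z_mat_def table_def s_def Let_def)
  then show ?thesis
    using abs_det_eq[OF mons(1)[OF s(1)] mons(1)[OF s(2)], of incidence]
    unfolding mons(2)[OF s(1)] mons(2)[OF s(2)] by simp
qed

text \<open>
  The rows of \<open>N_mat\<close> are the forms $x^i y^j (x+y)^c$ and $x^{\alpha+i} y^{\beta+j} (x+y)^\gamma$,
  its columns the monomials $x^p y^q$ that are multiples of neither $x^a$ nor $y^b$; row and column
  indices count the exponent of $y$ upwards. The substitution contributes only the row signs
  $(-1)^c$ and $(-1)^\gamma$.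
\<close>

lemma abs_det_N_mat:
  fixes n A B C M :: nat
  assumes n: "3 * n = a + b + c + \<alpha> + \<beta> + \<gamma>"
    and A: "n = a + A" and B: "n = b + B" and C: "n = c + C" and M: "n = \<alpha> + \<beta> + \<gamma> + M"
    and less: "\<alpha> < a" "\<beta> < b" "\<gamma> < c"
  shows "\<bar>det (N_mat a b c \<alpha> \<beta> \<gamma>)\<bar>
    = abs_det subst_coeff ((+) (0, 0, c) ` z_free C \<union> (+) (\<alpha>, \<beta>, \<gamma>) ` z_free M)
        {m \<in> z_free n. A \<le> fst (snd m) \<and> fst (snd m) < b}"
    (is "_ = abs_det subst_coeff ?R ?T")
proof -
  have b: "b = A + C + M"
    using assms by linarith
  define row where "row i = (if i < C then (C - 1 - i, i, c) else (\<alpha> + (M - 1 - (i - C)), \<beta> + (i - C), \<gamma>))" for i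
  define col where "col j = (n - 1 - (A + j), A + j, 0 :: nat)" for j
  have R: "?R = row ` {..<C + M}"
  proof -
    have "(0, 0, c) + m \<in> row ` {..<C + M}" if "m \<in> z_free C" for m
    proof (rule image_eqI)
      show "(0, 0, c) + m = row (fst (snd m))" "fst (snd m) \<in> {..<C + M}"
        using that by (cases m; auto simp: row_def z_free_def layer_def)+
    qed
    moreover have "(\<alpha>, \<beta>, \<gamma>) + m \<in> row ` {..<C + M}" if "m \<in> z_free M" for m
    proof (rule image_eqI)
      show "(\<alpha>, \<beta>, \<gamma>) + m = row (C + fst (snd m))" "C + fst (snd m) \<in> {..<C + M}"
        using that by (cases m; auto simp: row_def z_free_def layer_def)+
    qed
    moreover have "row i \<in> ?R" if "i < C + M" for i
    proof (cases "i < C")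
      case True
      then have "row i = (0, 0, c) + (C - 1 - i, i, 0)" "(C - 1 - i, i, 0) \<in> z_free C"
        by (auto simp: row_def z_free_def layer_def)
      then show ?thesis
        by blast
    next
      case False
      then have "row i = (\<alpha>, \<beta>, \<gamma>) + (M - 1 - (i - C), i - C, 0)"
          "(M - 1 - (i - C), i - C, 0) \<in> z_free M"
        using that by (auto simp: row_def z_free_def layer_def)
      then show ?thesis
        by blast
    qed
    ultimately show ?thesis
      by blast
  qed
  have T: "?T = col ` {..<C + M}"
  proof -
    have "m \<in> col ` {..<C + M}" if "m \<in> ?T" for m
    proof (rule image_eqI)
      show "m = col (fst (snd m) - A)" "fst (snd m) - A \<in> {..<C + M}"
        using that b by (cases m; auto simp: col_def z_free_def layer_def)+
    qed
    moreover have "col j \<in> ?T" if "j < C + M" for j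
      using that b B by (auto simp: col_def z_free_def layer_def)
    ultimately show ?thesis
      by blast
  qed
  have inj: "inj_on row {..<C + M}" "inj_on col {..<C + M}"
    using less by (auto simp: inj_on_def row_def col_def split: if_splits)
  have "par_s a b c \<alpha> \<beta> \<gamma> + 2 = int n"
    using n unfolding par_s_def by linarith
  then have par: "par_A a b c \<alpha> \<beta> \<gamma> = int A" "par_C a b c \<alpha> \<beta> \<gamma> = int C" "par_M a b c \<alpha> \<beta> \<gamma> = int M"
    using A C M by (auto simp: par_A_def par_C_def par_M_def)
  define e :: "monomial \<Rightarrow> int" where "e m = (-1) ^ snd (snd m)" for m
  define f where "f m t = binom (snd (snd m)) (int (fst (snd t)) - int (fst (snd m)))"
    for m t :: monomial
  have "subst_coeff = (\<lambda>m t. e m * f m t)"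
    by (auto simp: fun_eq_iff e_def f_def)
  then have "abs_det subst_coeff ?R ?T = abs_det (\<lambda>m t. e m * f m t) ?R ?T"
    by (rule arg_cong[where f = "\<lambda>h. abs_det h ?R ?T"])
  also have "\<dots> = abs_det f ?R ?T"
    by (rule abs_det_scale_rows) (simp_all add: e_def power_abs)
  also have "\<dots> = abs_det f (set (map row [0..<C + M])) (set (map col [0..<C + M]))"
    unfolding R T by (simp add: atLeast0LessThan)
  also have "\<dots> = \<bar>det (table f (map row [0..<C + M]) (map col [0..<C + M]))\<bar>"
    using inj by (intro abs_det_eq) (simp_all add: distinct_map atLeast0LessThan)
  also have "table f (map row [0..<C + M]) (map col [0..<C + M]) = N_mat a b c \<alpha> \<beta> \<gamma>"
    unfolding N_mat_def par Let_def
    by (rule eq_matI) (auto simp: table_def f_def row_def col_def nat_add_distrib algebra_simps)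
  finally show ?thesis
    by simp
qed

theorem theorem5p3:
  fixes a b c \<alpha> \<beta> \<gamma> :: nat
  assumes "\<alpha> < a" and "\<beta> < b" and "\<gamma> < c"
    and "\<not> (\<alpha> = 0 \<and> \<beta> = 0)" and "\<not> (\<alpha> = 0 \<and> \<gamma> = 0)" and "\<not> (\<beta> = 0 \<and> \<gamma> = 0)"
    and "(a + b + c + \<alpha> + \<beta> + \<gamma>) mod 3 = 0"
    and "0 \<le> par_M a b c \<alpha> \<beta> \<gamma>"
    and "0 \<le> par_A a b c \<alpha> \<beta> \<gamma>" and "par_A a b c \<alpha> \<beta> \<gamma> \<le> int (\<beta> + \<gamma>)"
    and "0 \<le> par_B a b c \<alpha> \<beta> \<gamma>" and "par_B a b c \<alpha> \<beta> \<gamma> \<le> int (\<alpha> + \<gamma>)"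
    and "0 \<le> par_C a b c \<alpha> \<beta> \<gamma>" and "par_C a b c \<alpha> \<beta> \<gamma> \<le> int (\<alpha> + \<beta>)"
  shows "\<bar>det (Z_mat a b c \<alpha> \<beta> \<gamma>)\<bar> = \<bar>det (N_mat a b c \<alpha> \<beta> \<gamma>)\<bar>"
proof -
  \<comment> \<open>\<open>n = s + 2\<close>, so that \<open>layer n\<close> consists of the monomials of degree \<open>s + 1\<close>.\<close>
  define n where "n = (a + b + c + \<alpha> + \<beta> + \<gamma>) div 3"
  have n3: "3 * n = a + b + c + \<alpha> + \<beta> + \<gamma>"
    unfolding n_def by (rule dvd_mult_div_cancel[OF mod_0_imp_dvd[OF assms(7)]])
  have s: "par_s a b c \<alpha> \<beta> \<gamma> + 2 = int n"
    using n3 unfolding par_s_def by linarith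
  define A B C M where "A = n - a" and "B = n - b" and "C = n - c" and "M = n - (\<alpha> + \<beta> + \<gamma>)"
  have eqs: "n = a + A" "n = b + B" "n = c + C" "n = \<alpha> + \<beta> + \<gamma> + M"
    and le: "A \<le> \<beta> + \<gamma>" "B \<le> \<alpha> + \<gamma>" "C \<le> \<alpha> + \<beta>"
    using assms(8-14) s unfolding par_A_def par_B_def par_C_def par_M_def A_def B_def C_def M_def
    by linarith+
  have pos: "0 < n"
    using n3 assms(1) by linarith
  define G where "G = {(a, 0, 0), (0, b, 0), (0, 0, c), (\<alpha>, \<beta>, \<gamma>)}"
  \<comment> \<open>The upper bounds on \<open>A\<close>, \<open>B\<close>, \<open>C\<close> say that $x^a$, $y^b$, $z^c$ have no common multiple with
    the fourth generator in degree \<open>n - 1\<close>; for two pure powers this follows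
    from \<open>A\<close>, \<open>B\<close>, \<open>C\<close>, \<open>M\<close> being nonnegative.\<close>
  have lcm: "n \<le> deg m" if "u \<in> G" "v \<in> G" "u \<noteq> v" "divides u m" "divides v m" for u v m
    using that eqs le n3 by (cases m) (auto simp: G_def)
  \<comment> \<open>The rows from $x^a$ and $y^b$ are unit vectors; \<open>XA\<close> and \<open>YB\<close> serve as their row labels and as
    the columns in which they have their entry 1.\<close>
  define XA YB where "XA = (+) (a, 0, 0) ` z_free A" and "YB = (+) (0, b, 0) ` z_free B"
  define R where "R = (+) (0, 0, c) ` z_free C \<union> (+) (\<alpha>, \<beta>, \<gamma>) ` z_free M"
  define T where "T = {m \<in> z_free n. A \<le> fst (snd m) \<and> fst (snd m) < b}"
  have XA: "XA = {m \<in> z_free n. fst (snd m) < A}"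
  proof -
    have "m \<in> XA" if "m \<in> z_free n" "fst (snd m) < A" for m
      unfolding XA_def
    proof (rule image_eqI)
      show "m = (a, 0, 0) + (fst m - a, fst (snd m), 0)" "(fst m - a, fst (snd m), 0) \<in> z_free A"
        using that eqs(1,2) n3 eqs(3,4) by (cases m; auto simp: z_free_def layer_def)+
    qed
    then show ?thesis
      using eqs(1) by (auto simp: XA_def z_free_def layer_def)
  qed
  have YB: "YB = {m \<in> z_free n. b \<le> fst (snd m)}"
  proof -
    have "m \<in> YB" if "m \<in> z_free n" "b \<le> fst (snd m)" for m
      unfolding YB_def
    proof (rule image_eqI)
      show "m = (0, b, 0) + (fst m, fst (snd m) - b, 0)" "(fst m, fst (snd m) - b, 0) \<in> z_free B"
        using that eqs(2) by (cases m; auto simp: z_free_def layer_def)+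
    qed
    then show ?thesis
      using eqs(2) by (auto simp: YB_def z_free_def layer_def)
  qed
  have cols: "z_free n = T \<union> (XA \<union> YB)"
    unfolding T_def XA YB by auto
  have rows: "(\<Union>v\<in>G. (+) v ` z_free (n - deg v)) = R \<union> (XA \<union> YB)"
    unfolding G_def R_def XA_def YB_def A_def B_def C_def M_def by auto
  have "\<bar>det (Z_mat a b c \<alpha> \<beta> \<gamma>)\<bar> = abs_det subst_coeff (R \<union> (XA \<union> YB)) (T \<union> (XA \<union> YB))"
    using abs_det_Z_mat[OF n3 pos] abs_det_quotient[of G n, OF _ lcm]
    unfolding G_def[symmetric] rows cols[symmetric] by (simp add: G_def)
  also have "\<dots> = abs_det subst_coeff R T * abs_det subst_coeff (XA \<union> YB) (XA \<union> YB)"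
  proof (rule abs_det_block)
    show "R \<inter> (XA \<union> YB) = {}"
      unfolding R_def XA_def YB_def using eqs le n3 assms(1-3) by (auto simp: z_free_def layer_def)
    show "T \<inter> (XA \<union> YB) = {}"
      unfolding T_def XA YB by auto
    show "subst_coeff u t = 0" if "u \<in> XA \<union> YB" "t \<in> T" for u t
      using that unfolding T_def XA YB by (cases u; cases t) (auto simp: z_free_def binom_def)
  qed (simp_all add: R_def T_def XA_def YB_def)
  also have "abs_det subst_coeff (XA \<union> YB) (XA \<union> YB) = 1"
    by (rule abs_det_z_free(1)[of _ n]) (auto simp: XA YB)
  also have "abs_det subst_coeff R T = \<bar>det (N_mat a b c \<alpha> \<beta> \<gamma>)\<bar>"
    unfolding R_def T_def using abs_det_N_mat[OF n3 eqs assms(1-3)] by simp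
  finally show ?thesis
    by simp
qed

end
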